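(* Let $f:\mathbb{R}^D\to\mathbb{R}$ be the prediction function of a deep network with continuous, piecewise affine activations, so that $f$ is continuous and piecewise affine and is written $f(\mathbf{x})=\mathbf{A}[\mathbf{x}]\,\mathbf{x}+b[\mathbf{x}]$ for all $\mathbf{x}\in\mathbb{R}^D$, where $\mathbf{A}[\cdot]$ and $b[\cdot]$ are constant on each region of the network's partition of $\mathbb{R}^D$. Let $(\mathbf{x}_i,y_i)$, $i=1,\dots,n$, be training data with $\|\mathbf{x}_i\|_2\le R$ for all $i$. Assume that $f$ has Lipschitz constant $K_1$, that is, $\|\mathbf{A}[\mathbf{x}]\|_2\le K_1$ for all $\mathbf{x}\in\mathbb{R}^D$. Let $\ell(\cdot,\cdot)$ be a convex loss function that has Lipschitz constant $K_2$ (in its first argument, the prediction). Let $m\ge 1$ and let $\mathbf{u}_{ij}\in\mathbb{R}^D$ ($1\le i\le n$, $1\le j\le m$) satisfy $\|\mathbf{u}_{ij}\|_2\le\varepsilon$. Define $$\mathcal{L}=\sum_{i=1}^n \ell(f(\mathbf{x}_i),y_i),\qquad \mathcal{L}^{\rm aug}=\frac{1}{m+1}\sum_{i=1}^n\Big(\ell(f(\mathbf{x}_i),y_i)+\sum_{j=1}^m \ell(f(\mathbf{x}_i+\mathbf{u}_{ij}),y_i)\Big).$$ Then $$\mathcal{L}^{\rm aug}\le \mathcal{L}+\frac{RK_2}{m+1}\sum_{i=1}^n\sum_{j=1}^m\big\|\mathbf{A}[\mathbf{x}_i+\mathbf{u}_{ij}]-\mathbf{A}[\mathbf{x}_i]\big\|_2+\frac{K_2}{m+1}\sum_{i=1}^n\sum_{j=1}^m\big|b[\mathbf{x}_i+\mathbf{u}_{ij}]-b[\mathbf{x}_i]\big|+\frac{K_1K_2mn\varepsilon}{m+1}+o(\varepsilon),$$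 where $o(\varepsilon)$ denotes a term $r(\varepsilon)$ with $r(\varepsilon)/\varepsilon\to 0$ as $\varepsilon\to 0^+$, for $f$, $\ell$, the training data and $m$ fixed.
   Context: A deep network built with continuous, piecewise affine activations (e.g. ReLU, leaky ReLU, absolute value) partitions its input space $\mathbb{R}^D$ into finitely many regions $\mathscr{Q}_j$ (the vector quantization, or VQ, regions) according to the activation pattern of its units. For $\mathbf{x}\in\mathbb{R}^D$, $\mathscr{Q}(\mathbf{x})$ denotes the region containing $\mathbf{x}$. Inside each region $f$ is an affine map, so $f(\mathbf{x})=\mathbf{A}_{\mathscr{Q}(\mathbf{x})}\mathbf{x}+b_{\mathscr{Q}(\mathbf{x})}$, abbreviated $f(\mathbf{x})=\mathbf{A}[\mathbf{x}]\mathbf{x}+b[\mathbf{x}]$. Here the output is scalar, so $\mathbf{A}[\mathbf{x}]$ is a $1\times D$ row vector, $b[\mathbf{x}]\in\mathbb{R}$, and $\|\mathbf{A}[\mathbf{x}]\|_2$ is the Euclidean (equivalently operator) norm. $\mathcal{L}$ is the training loss on the original data and $\mathcal{L}^{\rm aug}$ is the training loss after data augmentation, in which each $\mathbf{x}_i$ is supplemented by $m$ perturbed points $\mathbf{x}_i+\mathbf{u}_{ij}$ having the same label $y_i$. *)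

theory Defs
  imports "HOL-Analysis.Analysis" "HOL-Library.Disjoint_Sets"
begin

text \<open>The pieces of an activation are part of the data, since they determine the activation
  pattern.  They partition the real line, so that every real number lies in exactly one piece;
  which of two neighbouring pieces contains a breakpoint is left to the activation.\<close>

record activation =
  act_fun :: "real \<Rightarrow> real"
  act_pieces :: "real set set"

definition cpa_activation :: "activation \<Rightarrow> bool" where
  "cpa_activation s \<longleftrightarrow>
     continuous_on UNIV (act_fun s) \<and>
     finite (act_pieces s) \<and> partition_on UNIV (act_pieces s) \<and>
     (\<forall>I\<in>act_pieces s. is_interval I \<and> interior I \<noteq> {} \<and>
        (\<exists>a c. \<forall>t\<in>I. act_fun s t = a * t + c))"

definition act_piece :: "activation \<Rightarrow> real \<Rightarrow> real set" where
  "act_piece s t = (THE I. I \<in> act_pieces s \<and> t \<in> I)"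

text \<open>The hidden layers are those with index \<open>l < depth N\<close>, and layer \<open>l\<close> has the units
  \<open>k < width N l\<close>.  Layer \<open>depth N\<close> is the affine output layer, of which only unit 0 is used.
  Activations may differ from unit to unit; in particular identity units are allowed, by which
  skip connections are covered.\<close>

record 'd network =
  depth :: nat
  width :: "nat \<Rightarrow> nat"
  in_weight :: "nat \<Rightarrow> real ^ 'd"
  weight :: "nat \<Rightarrow> nat \<Rightarrow> nat \<Rightarrow> real"
  bias :: "nat \<Rightarrow> nat \<Rightarrow> real"
  act :: "nat \<Rightarrow> nat \<Rightarrow> activation"

fun preact :: "('d::finite) network \<Rightarrow> nat \<Rightarrow> nat \<Rightarrow> real ^ 'd \<Rightarrow> real" where
  "preact N 0 k x = in_weight N k \<bullet> x + bias N 0 k"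
| "preact N (Suc l) k x =
     (\<Sum>j<width N l. weight N (Suc l) k j * act_fun (act N l j) (preact N l j x)) + bias N (Suc l) k"

definition net_fun :: "('d::finite) network \<Rightarrow> real ^ 'd \<Rightarrow> real" where
  "net_fun N x = preact N (depth N) 0 x"

definition cpa_network :: "('d::finite) network \<Rightarrow> bool" where
  "cpa_network N \<longleftrightarrow> (\<forall>l<depth N. \<forall>k<width N l. cpa_activation (act N l k))"

text \<open>The VQ region containing \<open>x\<close>: all inputs with the same activation pattern as \<open>x\<close>.\<close>

definition vq_region :: "('d::finite) network \<Rightarrow> real ^ 'd \<Rightarrow> (real ^ 'd) set" where
  "vq_region N x = {x'. \<forall>l<depth N. \<forall>k<width N l.
     act_piece (act N l k) (preact N l k x') = act_piece (act N l k) (preact N l k x)}"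

definition train_loss ::
  "(real \<Rightarrow> 'y \<Rightarrow> real) \<Rightarrow> ('a \<Rightarrow> real) \<Rightarrow> nat \<Rightarrow> (nat \<Rightarrow> 'a) \<Rightarrow> (nat \<Rightarrow> 'y) \<Rightarrow> real" where
  "train_loss loss f n x y = (\<Sum>i=1..n. loss (f (x i)) (y i))"

definition aug_loss ::
  "(real \<Rightarrow> 'y \<Rightarrow> real) \<Rightarrow> ('a::plus \<Rightarrow> real) \<Rightarrow> nat \<Rightarrow> nat \<Rightarrow> (nat \<Rightarrow> 'a) \<Rightarrow> (nat \<Rightarrow> 'y) \<Rightarrow>
    (nat \<Rightarrow> nat \<Rightarrow> 'a) \<Rightarrow> real" where
  "aug_loss loss f n m x y u =
     1 / (real m + 1) *
     (\<Sum>i=1..n. loss (f (x i)) (y i) + (\<Sum>j=1..m. loss (f (x i + u i j)) (y i)))"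

text \<open>The network is affine on each of its regions, so coefficients indexed by the regions
  exist.\<close>

lemma act_piece_props:
  assumes "cpa_activation s"
  shows "act_piece s t \<in> act_pieces s" "t \<in> act_piece s t"
proof -
  have P: "partition_on UNIV (act_pieces s)"
    using assms by (simp add: cpa_activation_def)
  then have "\<exists>!I. I \<in> act_pieces s \<and> t \<in> I"
    unfolding partition_on_def disjoint_def by blast
  from theI'[OF this] show "act_piece s t \<in> act_pieces s" "t \<in> act_piece s t"
    by (auto simp: act_piece_def)
qed

lemma preact_affine_on_region:
  assumes N: "cpa_network N" and "l \<le> depth N"
  shows "\<exists>a c. \<forall>z\<in>vq_region N x. preact N l k z = a \<bullet> z + c"
  using assms(2)
proof (induction l arbitrary: k)
  case 0
  then show ?case by auto
next
  case (Suc l)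
  have "\<exists>a c. \<forall>z\<in>vq_region N x. act_fun (act N l j) (preact N l j z) = a \<bullet> z + c"
    if j: "j < width N l" for j
  proof -
    let ?s = "act N l j"
    let ?I = "act_piece ?s (preact N l j x)"
    have s: "cpa_activation ?s"
      using N Suc.prems j by (auto simp: cpa_network_def)
    then obtain p q where pq: "\<And>t. t \<in> ?I \<Longrightarrow> act_fun ?s t = p * t + q"
      using act_piece_props(1)[OF s] unfolding cpa_activation_def by metis
    obtain a c where ac: "\<And>z. z \<in> vq_region N x \<Longrightarrow> preact N l j z = a \<bullet> z + c"
      using Suc.IH[of j] Suc.prems by auto
    have "act_fun ?s (preact N l j z) = (p *\<^sub>R a) \<bullet> z + (p * c + q)" if z: "z \<in> vq_region N x" for z
    proof -
      have "act_piece ?s (preact N l j z) = ?I"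
        using z j Suc.prems by (auto simp: vq_region_def)
      then have "preact N l j z \<in> ?I"
        using act_piece_props(2)[OF s] by metis
      then show ?thesis
        using pq ac[OF z] by (simp add: algebra_simps)
    qed
    then show ?thesis by blast
  qed
  then obtain a c where ac: "\<And>j z. j < width N l \<Longrightarrow> z \<in> vq_region N x \<Longrightarrow>
      act_fun (act N l j) (preact N l j z) = a j \<bullet> z + c j"
    by metis
  have "preact N (Suc l) k z = (\<Sum>j<width N l. weight N (Suc l) k j *\<^sub>R a j) \<bullet> z
      + ((\<Sum>j<width N l. weight N (Suc l) k j * c j) + bias N (Suc l) k)"
    if "z \<in> vq_region N x" for z
    using that by (simp add: ac inner_sum_left sum.distrib algebra_simps)
  then show ?case by blast
qed

lemma ex_affine_coefficients:
  assumes "cpa_network N"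
  shows "\<exists>A b. \<forall>x. net_fun N x = A (vq_region N x) \<bullet> x + b (vq_region N x)"
proof -
  have "\<forall>Q\<in>range (vq_region N). \<exists>a c. \<forall>z\<in>Q. net_fun N z = a \<bullet> z + c"
    using preact_affine_on_region[OF assms order_refl] by (auto simp: net_fun_def)
  then obtain A b where "\<And>Q z. Q \<in> range (vq_region N) \<Longrightarrow> z \<in> Q \<Longrightarrow> net_fun N z = A Q \<bullet> z + b Q"
    by metis
  moreover have "x \<in> vq_region N x" for x
    by (simp add: vq_region_def)
  ultimately show ?thesis by blast
qed

end

theory Submission
  imports Defs
begin

text \<open>The augmented loss is the training loss plus 1/(m+1) times the sum of the loss
  increments from \<open>x i\<close> to \<open>x i + u i j\<close> (\<open>aug_loss_eq\<close>), so
  it suffices to bound each increment. At both points f equals an affine map, with the coefficients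
  A, b of the region of \<open>x i\<close> and A', b' of the region of the perturbed point. The
  predictions differ by (A' - A) x + (b' - b) + A' u, and Cauchy-Schwarz with the Lipschitz property
  of the loss bounds the increment by K2 (R |A' - A| + |b' - b| + K1 \<epsilon>)
  (\<open>lipschitz_on_affine_perturbation\<close>). Summing over all pairs gives the inequality,
  with remainder 0.\<close>

lemma lipschitz_on_affine_perturbation:
  fixes A A' x u :: "'a::real_inner"
  assumes lip: "L-lipschitz_on UNIV g"
    and x: "norm x \<le> R" and u: "norm u \<le> \<epsilon>" and A': "norm A' \<le> K"
  shows "g (A' \<bullet> (x + u) + b') - g (A \<bullet> x + b)
    \<le> L * (R * norm (A' - A) + \<bar>b' - b\<bar> + K * \<epsilon>)"
proof -
  have "0 \<le> K"
    using A' norm_ge_zero order_trans by blast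
  \<comment> \<open>The change of slope is paired with the data point, whose norm is at most R, and
    the perturbation with the new slope A', whose norm is at most K.\<close>
  have "A' \<bullet> (x + u) + b' - (A \<bullet> x + b) = (A' - A) \<bullet> x + (b' - b) + A' \<bullet> u"
    by (simp add: algebra_simps)
  also have "\<bar>\<dots>\<bar> \<le> \<bar>(A' - A) \<bullet> x\<bar> + \<bar>b' - b\<bar> + \<bar>A' \<bullet> u\<bar>"
    by linarith
  also have "\<bar>(A' - A) \<bullet> x\<bar> \<le> norm (A' - A) * norm x"
    by (rule Cauchy_Schwarz_ineq2)
  also have "\<dots> \<le> R * norm (A' - A)"
    using x by (simp add: mult.commute mult_right_mono)
  also have "\<bar>A' \<bullet> u\<bar> \<le> norm A' * norm u"
    by (rule Cauchy_Schwarz_ineq2)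
  also have "\<dots> \<le> K * \<epsilon>"
    using A' u \<open>0 \<le> K\<close> by (simp add: mult_mono)
  finally have bound: "\<bar>A' \<bullet> (x + u) + b' - (A \<bullet> x + b)\<bar>
      \<le> R * norm (A' - A) + \<bar>b' - b\<bar> + K * \<epsilon>"
    by simp
  have "g (A' \<bullet> (x + u) + b') - g (A \<bullet> x + b) \<le> L * \<bar>A' \<bullet> (x + u) + b' - (A \<bullet> x + b)\<bar>"
    using lipschitz_onD[OF lip, of "A' \<bullet> (x + u) + b'" "A \<bullet> x + b"]
    by (simp add: dist_real_def)
  also have "\<dots> \<le> L * (R * norm (A' - A) + \<bar>b' - b\<bar> + K * \<epsilon>)"
    using bound lipschitz_on_nonneg[OF lip] by (rule mult_left_mono)
  finally show ?thesis .
qed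

text \<open>Each sample contributes its unperturbed loss once directly and once as the baseline of
  each of its m increments. These m+1 copies cancel the factor 1/(m+1).\<close>

lemma aug_loss_eq:
  "aug_loss loss f n m x y u = train_loss loss f n x y +
     (\<Sum>i=1..n. \<Sum>j=1..m. loss (f (x i + u i j)) (y i) - loss (f (x i)) (y i)) / (real m + 1)"
proof -
  have "(\<Sum>i=1..n. \<Sum>j=1..m. loss (f (x i + u i j)) (y i) - loss (f (x i)) (y i)) =
      (\<Sum>i=1..n. loss (f (x i)) (y i) + (\<Sum>j=1..m. loss (f (x i + u i j)) (y i)))
      - (real m + 1) * (\<Sum>i=1..n. loss (f (x i)) (y i))"
    by (simp add: sum_subtractf sum.distrib sum_distrib_left algebra_simps)
  then show ?thesis
    by (simp add: aug_loss_def train_loss_def field_simps)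
qed

theorem theorem1:
  fixes N :: "('d::finite) network"
    and f :: "real ^ 'd \<Rightarrow> real"
    and A :: "(real ^ 'd) set \<Rightarrow> real ^ 'd" and b :: "(real ^ 'd) set \<Rightarrow> real"
    and n m :: nat
    and x :: "nat \<Rightarrow> real ^ 'd" and y :: "nat \<Rightarrow> 'y"
    and loss :: "real \<Rightarrow> 'y \<Rightarrow> real"
    and R K\<^sub>1 K\<^sub>2 :: real
  assumes "cpa_network N" and "f = net_fun N"
    and "\<forall>z. f z = A (vq_region N z) \<bullet> z + b (vq_region N z)"
    and "\<forall>i\<in>{1..n}. norm (x i) \<le> R"
    and "\<forall>z. norm (A (vq_region N z)) \<le> K\<^sub>1"
    and "\<forall>v. convex_on UNIV (\<lambda>p. loss p v)"
    and "\<forall>v. K\<^sub>2-lipschitz_on UNIV (\<lambda>p. loss p v)"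
    and "m \<ge> 1"
  shows "\<exists>r :: real \<Rightarrow> real.
    ((\<lambda>\<epsilon>. r \<epsilon> / \<epsilon>) \<longlongrightarrow> 0) (at_right 0) \<and>
    (\<forall>\<epsilon> (u :: nat \<Rightarrow> nat \<Rightarrow> real ^ 'd).
      (\<forall>i\<in>{1..n}. \<forall>j\<in>{1..m}. norm (u i j) \<le> \<epsilon>) \<longrightarrow>
      aug_loss loss f n m x y u \<le>
        train_loss loss f n x y
        + R * K\<^sub>2 / (real m + 1) *
          (\<Sum>i=1..n. \<Sum>j=1..m. norm (A (vq_region N (x i + u i j)) - A (vq_region N (x i))))
        + K\<^sub>2 / (real m + 1) *
          (\<Sum>i=1..n. \<Sum>j=1..m. \<bar>b (vq_region N (x i + u i j)) - b (vq_region N (x i))\<bar>)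
        + K\<^sub>1 * K\<^sub>2 * real m * real n * \<epsilon> / (real m + 1)
        + r \<epsilon>)"
\<comment> \<open>The increment bound is exact for every \<epsilon>, so the zero function serves as
  the o(\<epsilon>) term.\<close>
proof (intro exI[where x = "\<lambda>_. 0"] conjI allI impI)
  show "((\<lambda>\<epsilon>. 0 / \<epsilon>) \<longlongrightarrow> (0::real)) (at_right 0)"
    by simp
next
  fix \<epsilon> :: real and u :: "nat \<Rightarrow> nat \<Rightarrow> real ^ 'd"
  assume u: "\<forall>i\<in>{1..n}. \<forall>j\<in>{1..m}. norm (u i j) \<le> \<epsilon>"
  let ?dA = "\<lambda>i j. norm (A (vq_region N (x i + u i j)) - A (vq_region N (x i)))"
  let ?db = "\<lambda>i j. \<bar>b (vq_region N (x i + u i j)) - b (vq_region N (x i))\<bar>"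
  have "loss (f (x i + u i j)) (y i) - loss (f (x i)) (y i)
      \<le> K\<^sub>2 * (R * ?dA i j + ?db i j + K\<^sub>1 * \<epsilon>)" if "i \<in> {1..n}" "j \<in> {1..m}" for i j
    \<comment> \<open>Both values of \<open>f\<close> become affine expressions, each with the
      coefficients of its own region; the two regions may differ.\<close>
    unfolding assms(3)[rule_format]
    by (rule lipschitz_on_affine_perturbation) (use assms u that in auto)
  then have "(\<Sum>i=1..n. \<Sum>j=1..m. loss (f (x i + u i j)) (y i) - loss (f (x i)) (y i))
      \<le> (\<Sum>i=1..n. \<Sum>j=1..m. K\<^sub>2 * (R * ?dA i j + ?db i j + K\<^sub>1 * \<epsilon>))"
    by (intro sum_mono)
  \<comment> \<open>The last summand is the same for all n * m pairs, which yields the factor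
    \<open>real m * real n\<close>.\<close>
  also have "\<dots> = R * K\<^sub>2 * (\<Sum>i=1..n. \<Sum>j=1..m. ?dA i j)
      + K\<^sub>2 * (\<Sum>i=1..n. \<Sum>j=1..m. ?db i j) + K\<^sub>1 * K\<^sub>2 * real m * real n * \<epsilon>"
    by (simp add: sum.distrib sum_distrib_left algebra_simps)
  finally show "aug_loss loss f n m x y u \<le>
        train_loss loss f n x y
        + R * K\<^sub>2 / (real m + 1) * (\<Sum>i=1..n. \<Sum>j=1..m. ?dA i j)
        + K\<^sub>2 / (real m + 1) * (\<Sum>i=1..n. \<Sum>j=1..m. ?db i j)
        + K\<^sub>1 * K\<^sub>2 * real m * real n * \<epsilon> / (real m + 1)
        + 0"
    unfolding aug_loss_eq
    by (simp add: divide_right_mono flip: add_divide_distrib)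
qed

end
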